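(* For every positive integer $n$, $$\max\bigl(4,\log_2(n+4)\bigr)\le t(n).$$ In particular, $t(n)\to\infty$ as $n\to\infty$.
   Context: A $\mathbb Z$-lattice is a free $\mathbb Z$-module of finite rank equipped with a positive definite symmetric bilinear form with values in $\mathbb Z$; $Q(\bm x)=B(\bm x,\bm x)$. An integer $m$ is represented by $L$ if $m=Q(\bm x)$ for some $\bm x\in L$. For a positive integer $n$, $\mathcal T(n)$ is the set of all integers $\ge n$. A $\mathbb Z$-lattice $L$ is tight $\mathcal T(n)$-universal if the set of nonzero integers represented by $L$ is exactly $\mathcal T(n)$. $t(n)$ denotes the smallest rank of a tight $\mathcal T(n)$-universal $\mathbb Z$-lattice. *)

theory Defs
  imports "HOL-Analysis.Analysis" "HOL-Library.Poly_Mapping"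
begin

text \<open>The canonical integer multiple \<open>k x\<close> in an abelian group: a \<open>k\<close>-fold sum of \<open>x\<close>, or the
  negative of a \<open>-k\<close>-fold sum (at most one of the two sums below is nonempty).\<close>

definition zscale :: "int \<Rightarrow> 'a::ab_group_add \<Rightarrow> 'a" where
  "zscale k x = (\<Sum>i<nat k. x) - (\<Sum>i<nat (- k). x)"

lemma zscale_diff: "zscale (int m - int n) x = (\<Sum>i<m. x) - (\<Sum>i<n. x)"
proof -
  have add: "(\<Sum>i<a+b. x) = (\<Sum>i<a. x) + (\<Sum>i<b. x)" for a b :: nat
    by (induction b) (simp_all add: algebra_simps)
  show ?thesis
  proof (cases "n \<le> m")
    case True
    then obtain d where "m = n + d" using le_Suc_ex by blast
    then show ?thesis by (simp add: zscale_def add)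
  next
    case False
    then obtain d where "n = m + d" using le_Suc_ex nat_le_linear by blast
    then show ?thesis by (simp add: zscale_def add)
  qed
qed

global_interpretation zmod: module "zscale :: int \<Rightarrow> 'a::ab_group_add \<Rightarrow> 'a"
proof
  fix a b :: int and x y :: 'a
  have add: "(\<Sum>i<k+l. x) = (\<Sum>i<k. x) + (\<Sum>i<l. x)" for k l :: nat and x :: 'a
    by (induction l) (simp_all add: algebra_simps)
  have mult: "(\<Sum>i<k*l. x) = (\<Sum>i<k. (\<Sum>i<l. x))" for k l :: nat and x :: 'a
    by (induction k) (simp_all add: add add.commute)
  obtain m n where a: "a = int m - int n" by (rule int_diff_cases)
  obtain p q where b: "b = int p - int q" by (rule int_diff_cases)
  show "zscale a (x + y) = zscale a x + zscale a y"
    by (simp add: zscale_def sum.distrib)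
  have "a + b = int (m + p) - int (n + q)" by (simp add: a b)
  then show "zscale (a + b) x = zscale a x + zscale b x"
    by (simp only: a b zscale_diff add) (simp add: algebra_simps)
  have "a * b = int (m * p + n * q) - int (m * q + n * p)" by (simp add: a b algebra_simps)
  then show "zscale a (zscale b x) = zscale (a * b) x"
    by (simp only: a b zscale_diff add mult sum_subtractf) (simp add: algebra_simps)
  show "zscale 1 x = x"
    by (simp add: zscale_def)
qed

text \<open>Modules live on subsets of a type that is an abelian group.\<close>

definition free_zmodule_of_rank :: "nat \<Rightarrow> 'a::ab_group_add set \<Rightarrow> bool" where
  "free_zmodule_of_rank r L \<longleftrightarrow>
     (\<exists>X. finite X \<and> card X = r \<and> zmod.independent X \<and> zmod.span X = L)"

text \<open>Linearity in the second argument is a consequence of symmetry.\<close>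

definition z_lattice :: "'a::ab_group_add set \<Rightarrow> ('a \<Rightarrow> 'a \<Rightarrow> int) \<Rightarrow> bool" where
  "z_lattice L B \<longleftrightarrow>
     (\<exists>r. free_zmodule_of_rank r L) \<and>
     (\<forall>x\<in>L. \<forall>y\<in>L. B x y = B y x) \<and>
     (\<forall>x\<in>L. \<forall>y\<in>L. \<forall>z\<in>L. B (x + y) z = B x z + B y z) \<and>
     (\<forall>k. \<forall>x\<in>L. \<forall>y\<in>L. B (zscale k x) y = k * B x y) \<and>
     (\<forall>x\<in>L. x \<noteq> 0 \<longrightarrow> 0 < B x x)"

definition represents :: "'a set \<Rightarrow> ('a \<Rightarrow> 'a \<Rightarrow> int) \<Rightarrow> int \<Rightarrow> bool" where
  "represents L B m \<longleftrightarrow> (\<exists>x\<in>L. m = B x x)"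

definition T_set :: "nat \<Rightarrow> int set" where
  "T_set n = {m. int n \<le> m}"

definition tight_universal :: "nat \<Rightarrow> 'a::ab_group_add set \<Rightarrow> ('a \<Rightarrow> 'a \<Rightarrow> int) \<Rightarrow> bool" where
  "tight_universal n L B \<longleftrightarrow>
     z_lattice L B \<and> {m. m \<noteq> 0 \<and> represents L B m} = T_set n"

text \<open>A set of ranks has to be formed over one fixed type. We take \<open>nat \<Rightarrow>\<^sub>0 int\<close>, the free abelian
  group of countably infinite rank; it contains a copy of every free module of finite rank, and
  \<open>is_tight_rank_transfer\<close> below shows that lattices in any other type yield no further ranks.\<close>

definition is_tight_rank :: "nat \<Rightarrow> nat \<Rightarrow> bool" where
  "is_tight_rank n r \<longleftrightarrow>
     (\<exists>(L :: (nat \<Rightarrow>\<^sub>0 int) set) B. free_zmodule_of_rank r L \<and> tight_universal n L B)"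

definition tight_rank :: "nat \<Rightarrow> nat" where
  "tight_rank n = (LEAST r. is_tight_rank n r)"

lemma lookup_zscale: "Poly_Mapping.lookup (zscale k f) i = k * Poly_Mapping.lookup f i"
proof -
  have "Poly_Mapping.lookup (\<Sum>j<m. f) i = int m * Poly_Mapping.lookup f i" for m :: nat
    by (induction m) (simp_all add: lookup_add algebra_simps)
  then show ?thesis
    by (cases "0 \<le> k") (simp_all add: zscale_def lookup_minus)
qed

lemma is_tight_rank_transfer:
  fixes L :: "'a::ab_group_add set"
  assumes free: "free_zmodule_of_rank r L" and tight: "tight_universal n L B"
  shows "is_tight_rank n r"
proof -
  obtain X where X: "finite X" "card X = r" "zmod.independent X" "zmod.span X = L"
    using free by (auto simp: free_zmodule_of_rank_def)
  obtain e where e: "bij_betw e {..<r} X"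
    using ex_bij_betw_nat_finite[OF X(1)] X(2) by (auto simp: atLeast0LessThan)
  define E :: "nat \<Rightarrow> nat \<Rightarrow>\<^sub>0 int" where "E i = Poly_Mapping.single i 1" for i
  have injE: "inj_on E A" for A
    by (rule inj_onI) (metis E_def lookup_single_eq lookup_single_not_eq zero_neq_one)
  define Y where "Y = E ` {..<r}"
  define M where "M = zmod.span Y"
  have cardY: "card Y = r" "finite Y" by (simp_all add: Y_def card_image injE)
  have lookupE: "Poly_Mapping.lookup (\<Sum>j<r. zscale (c j) (E j)) i = (if i < r then c i else 0)" for c i
    by (simp add: lookup_sum lookup_zscale E_def if_distrib[of "(*) _"] cong: if_cong)
  have "f y = 0" if f: "(\<Sum>x\<in>Y. zscale (f x) x) = 0" and "y \<in> Y" for f y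
  proof -
    obtain i where i: "i < r" "y = E i" using \<open>y \<in> Y\<close> by (auto simp: Y_def)
    have "(\<Sum>j<r. zscale (f (E j)) (E j)) = 0"
      using f by (simp add: Y_def sum.reindex injE)
    then show "f y = 0" using lookupE[of "f \<circ> E" i] i by simp
  qed
  then have "zmod.independent Y"
    unfolding zmod.dependent_finite[OF cardY(2)] by blast
  then have freeM: "free_zmodule_of_rank r M"
    unfolding free_zmodule_of_rank_def M_def using cardY by blast
  define \<phi> where "\<phi> f = (\<Sum>j<r. zscale (Poly_Mapping.lookup f j) (e j))" for f :: "nat \<Rightarrow>\<^sub>0 int"
  have \<phi>_add: "\<phi> (f + g) = \<phi> f + \<phi> g" for f g
    by (simp add: \<phi>_def lookup_add zmod.scale_left_distrib sum.distrib)
  have \<phi>_scale: "\<phi> (zscale k f) = zscale k (\<phi> f)" for k f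
    by (simp add: \<phi>_def lookup_zscale zmod.scale_sum_right)
  have eX: "e j \<in> X" if "j < r" for j using e that by (auto simp: bij_betw_def)
  have \<phi>_L: "\<phi> f \<in> L" for f
    unfolding \<phi>_def X(4)[symmetric]
    by (intro zmod.span_sum zmod.span_scale zmod.span_base eX) auto
  have M_eq: "f \<in> M \<longleftrightarrow> (\<exists>c. f = (\<Sum>j<r. zscale (c j) (E j)))" for f
  proof
    assume "f \<in> M"
    then obtain u where "f = (\<Sum>y\<in>Y. zscale (u y) y)"
      unfolding M_def zmod.span_finite[OF cardY(2)] by auto
    then have "f = (\<Sum>j<r. zscale (u (E j)) (E j))"
      by (simp add: Y_def sum.reindex injE)
    then show "\<exists>c. f = (\<Sum>j<r. zscale (c j) (E j))" by (intro exI[of _ "u \<circ> E"]) simp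
  next
    assume "\<exists>c. f = (\<Sum>j<r. zscale (c j) (E j))"
    moreover have "zscale k (E j) \<in> M" if "j < r" for k j
      unfolding M_def by (intro zmod.span_scale zmod.span_base) (use that in \<open>auto simp: Y_def\<close>)
    ultimately show "f \<in> M"
      unfolding M_def by (auto intro: zmod.span_sum)
  qed
  have \<phi>_onto: "\<exists>f\<in>M. \<phi> f = x" if "x \<in> L" for x
  proof -
    obtain u where u: "x = (\<Sum>y\<in>X. zscale (u y) y)"
      using \<open>x \<in> L\<close> unfolding X(4)[symmetric] zmod.span_finite[OF X(1)] by auto
    define f where "f = (\<Sum>j<r. zscale (u (e j)) (E j))"
    have "\<phi> f = (\<Sum>j<r. zscale (u (e j)) (e j))"
      unfolding \<phi>_def f_def using lookupE[of "u \<circ> e"] by (intro sum.cong) auto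
    also have "\<dots> = x" unfolding u using e by (rule sum.reindex_bij_betw)
    finally show ?thesis using M_eq f_def by (metis comp_apply)
  qed
  have \<phi>_zero: "f = 0" if "f \<in> M" "\<phi> f = 0" for f
  proof -
    obtain c where c: "f = (\<Sum>j<r. zscale (c j) (E j))" using M_eq \<open>f \<in> M\<close> by blast
    define g where "g = inv_into {..<r} e"
    have g: "g (e j) = j" if "j < r" for j
      using e that by (simp add: g_def bij_betw_def)
    have "(\<Sum>x\<in>X. zscale (Poly_Mapping.lookup f (g x)) x) = (\<Sum>j<r. zscale (Poly_Mapping.lookup f (g (e j))) (e j))"
      by (rule sum.reindex_bij_betw[OF e, symmetric])
    also have "\<dots> = 0" using \<open>\<phi> f = 0\<close> g by (simp add: \<phi>_def)
    finally have "\<forall>x\<in>X. Poly_Mapping.lookup f (g x) = 0"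
      using X(1,3) zmod.independentD[of X X "\<lambda>x. Poly_Mapping.lookup f (g x)"] by blast
    then have "Poly_Mapping.lookup f j = 0" if "j < r" for j using g eX that by metis
    then have "Poly_Mapping.lookup f j = 0" for j unfolding c lookupE by (cases "j < r") (auto simp: lookupE)
    then show "f = 0" by (intro poly_mapping_eqI) simp
  qed
  define C where "C f g = B (\<phi> f) (\<phi> g)" for f g
  have "z_lattice L B" using tight by (simp add: tight_universal_def)
  moreover have "\<phi> f \<noteq> 0" if "f \<in> M" "f \<noteq> 0" for f using \<phi>_zero that by blast
  ultimately have "z_lattice M C"
    unfolding z_lattice_def C_def using freeM \<phi>_L by (auto simp: \<phi>_add \<phi>_scale)
  moreover have "represents M C m \<longleftrightarrow> represents L B m" for m
    unfolding represents_def C_def using \<phi>_L \<phi>_onto by metis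
  ultimately have "tight_universal n M C" using tight by (simp add: tight_universal_def)
  then show ?thesis unfolding is_tight_rank_def using freeM by blast
qed

end

theory Submission
  imports Defs "HOL-Number_Theory.Cong" "HOL-Computational_Algebra.Squarefree"
begin

text \<open>Rank at least 4: clearing denominators in an orthogonalisation, a lattice of rank at most 3
  that represents all large integers yields \<open>a, b > 0\<close> such that \<open>x\<^sup>2 + a y\<^sup>2 + b z\<^sup>2\<close> represents all
  large multiples of some \<open>s > 0\<close>. This property allows a Legendre descent: one may take \<open>b\<close>
  squarefree and \<open>a \<le> b\<close>; it forces \<open>-a\<close> to be a square modulo each prime divisor of \<open>b\<close>, hence
  \<open>t\<^sup>2 + a = b c\<close> with \<open>c < b\<close>, and multiplying by the norm \<open>b c\<close> replaces \<open>b\<close> by \<open>c\<close>. The descent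
  ends at \<open>x\<^sup>2 + y\<^sup>2 + z\<^sup>2\<close>, which misses the numbers \<open>4\<^sup>e (8 k + 7)\<close>.

  Logarithmic bound: if \<open>x \<equiv> y\<close> modulo \<open>2 L\<close> and \<open>x \<noteq> \<plusminus> y\<close>, then \<open>Q x \<equiv> Q y\<close> modulo \<open>4\<close> and
  \<open>Q x + Q y = 2 (Q ((x + y) / 2) + Q ((x - y) / 2)) \<ge> 4 n\<close>. Hence suitable vectors of norms
  \<open>n, \<dots>, 2 n + 2\<close> lie in distinct nonzero classes of \<open>L / 2 L\<close>.

  The minimum defining \<open>t(n)\<close> exists because a diagonal form with four coefficients \<open>n\<close> gives, by
  Lagrange's four-square theorem, a tight universal lattice.\<close>

section \<open>Ternary forms\<close>

text \<open>The free factor \<open>s\<close> absorbs denominators and rescalings, the threshold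
  \<open>n\<close> finitely many exceptions. Coefficient 1 at \<open>x\<close> makes the first two
  terms a norm.\<close>

definition represents_multiples :: "int \<Rightarrow> int \<Rightarrow> bool" where
  "represents_multiples a b \<longleftrightarrow>
     (\<exists>s>0. \<exists>n. \<forall>m\<ge>n. \<exists>x y z. x\<^sup>2 + a * y\<^sup>2 + b * z\<^sup>2 = s * m)"

lemma represents_multiples_commute: "represents_multiples a b \<longleftrightarrow> represents_multiples b a"
proof -
  have "represents_multiples a b \<Longrightarrow> represents_multiples b a" for a b
    unfolding represents_multiples_def by (metis add.assoc add.commute)
  then show ?thesis by blast
qed

lemma represents_multiples_square:
  assumes "represents_multiples a (k\<^sup>2 * b)"
  shows "represents_multiples a b"
proof -
  have "k\<^sup>2 * b * z\<^sup>2 = b * (k * z)\<^sup>2" for z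
    by (simp add: power2_eq_square)
  with assms show ?thesis
    unfolding represents_multiples_def by metis
qed

text \<open>Multiplicativity of the norm \<open>x\<^sup>2 + a y\<^sup>2\<close>.\<close>

lemma represents_multiples_norm:
  assumes "represents_multiples a b" and bc: "t\<^sup>2 + a = b * c" and "b * c > 0"
  shows "represents_multiples a c"
proof -
  obtain s n where s: "s > 0" and rep: "\<forall>m\<ge>n. \<exists>x y z. x\<^sup>2 + a * y\<^sup>2 + b * z\<^sup>2 = s * m"
    using assms(1) unfolding represents_multiples_def by blast
  have "\<exists>x y z. x\<^sup>2 + a * y\<^sup>2 + c * z\<^sup>2 = (b * c * s) * m" if m: "m \<ge> n" for m
  proof -
    obtain x y z where xyz: "x\<^sup>2 + a * y\<^sup>2 + b * z\<^sup>2 = s * m"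
      using rep m by blast
    \<comment> \<open>With \<open>w\<close> a square root of \<open>-a\<close>, this is the norm of
      \<open>(t + w) * (x + w * y)\<close>; the last term is \<open>b * c\<close> times
      \<open>b * z^2\<close>.\<close>
    have "(t * x - a * y)\<^sup>2 + a * (x + t * y)\<^sup>2 + c * (b * z)\<^sup>2
        = (t\<^sup>2 + a) * (x\<^sup>2 + a * y\<^sup>2) + b * c * (b * z\<^sup>2)"
      by (simp add: power2_eq_square algebra_simps)
    also have "\<dots> = (b * c) * (x\<^sup>2 + a * y\<^sup>2 + b * z\<^sup>2)"
      unfolding bc by (simp add: algebra_simps)
    also have "\<dots> = (b * c * s) * m"
      unfolding xyz by simp
    finally show ?thesis by blast
  qed
  moreover have "b * c * s > 0" using assms(3) s by simp
  ultimately show ?thesis unfolding represents_multiples_def by blast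
qed

text \<open>If \<open>-a\<close> is a nonsquare modulo \<open>p\<close>, then
  \<open>x^2 + a * y^2\<close> is anisotropic modulo \<open>p\<close>. Hence a value
  \<open>p^(2e+1) * t\<close> of the form has \<open>t\<close> congruent to some
  \<open>b * z^2\<close>. Choosing a value with \<open>t\<close> congruent to \<open>-a * b\<close>
  makes \<open>-a\<close> a square after all.\<close>

lemma prime_dvd_square_plus:
  fixes p a :: int
  assumes p: "prime p" and rep: "represents_multiples a (p * b)" and b: "\<not> p dvd b"
  shows "\<exists>t. p dvd t\<^sup>2 + a"
proof (rule ccontr)
  assume nres: "\<not> ?thesis"
  have inv: "\<exists>w. p dvd w * y - 1" if "\<not> p dvd y" for y
  proof -
    have "coprime y p" using p that by (metis coprime_commute prime_imp_coprime)
    then obtain w where "[y * w = 1] (mod p)" using cong_solve_coprime_int by blast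
    then show ?thesis by (metis cong_iff_dvd_diff mult.commute)
  qed
  have aniso: "p dvd x \<and> p dvd y" if d: "p dvd x\<^sup>2 + a * y\<^sup>2" for x y
  proof -
    have "p dvd y"
    proof (rule ccontr)
      assume "\<not> p dvd y"
      then obtain w where w: "p dvd w * y - 1" using inv by blast
      have "(x * w)\<^sup>2 + a = w\<^sup>2 * (x\<^sup>2 + a * y\<^sup>2) - a * (w * y + 1) * (w * y - 1)"
        by (simp add: power2_eq_square algebra_simps)
      moreover have "p dvd w\<^sup>2 * (x\<^sup>2 + a * y\<^sup>2) - a * (w * y + 1) * (w * y - 1)"
        using d w by (meson dvd_diff dvd_mult)
      ultimately have "p dvd (x * w)\<^sup>2 + a" by simp
      then show False using nres by blast
    qed
    then have "p dvd a * y\<^sup>2" by (simp add: power2_eq_square)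
    then have "p dvd x\<^sup>2" using d by (simp add: dvd_add_left_iff)
    then have "p dvd x" using p prime_dvd_power by blast
    with \<open>p dvd y\<close> show ?thesis by blast
  qed
  have p0: "p \<noteq> 0" using p by auto
  \<comment> \<open>Anisotropy gives \<open>p\<close> dividing \<open>x\<close> and
    \<open>y\<close>. While the exponent is at least 3, \<open>p\<close> then divides
    \<open>z\<close> too, and \<open>p^2\<close> cancels. At exponent 1, dividing by
    \<open>p\<close> leaves \<open>t - b * z^2\<close> divisible by \<open>p\<close>.\<close>
  have descent: "\<exists>z. p dvd t - b * z\<^sup>2" if "x\<^sup>2 + a * y\<^sup>2 + p * b * z\<^sup>2 = p ^ (2 * e + 1) * t" for x y z e t
    using that
  proof (induction e arbitrary: x y z)
    case e: (0 x y z)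
    have "x\<^sup>2 + a * y\<^sup>2 + p * b * z\<^sup>2 = p * t" using e by simp
    moreover have "p * (t - b * z\<^sup>2) = p * t - p * b * z\<^sup>2" by (simp add: algebra_simps)
    ultimately have xy: "x\<^sup>2 + a * y\<^sup>2 = p * (t - b * z\<^sup>2)" by linarith
    then have "p dvd x \<and> p dvd y" using aniso by (metis dvd_triv_left)
    then obtain x' y' where x': "x = p * x'" "y = p * y'" by (auto elim!: dvdE)
    have "p * (p * (x'\<^sup>2 + a * y'\<^sup>2)) = x\<^sup>2 + a * y\<^sup>2"
      unfolding x' by (simp add: power2_eq_square algebra_simps)
    then have "t - b * z\<^sup>2 = p * (x'\<^sup>2 + a * y'\<^sup>2)" using p0 xy by (metis mult_left_cancel)
    then show ?case by (metis dvd_triv_left)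
  next
    case (Suc e)
    define q where "q = p ^ (2 * e + 1) * t"
    have eq: "x\<^sup>2 + a * y\<^sup>2 + p * b * z\<^sup>2 = p\<^sup>2 * q"
      using Suc.prems by (simp add: q_def power2_eq_square algebra_simps)
    moreover have "p * (p * q - b * z\<^sup>2) = p\<^sup>2 * q - p * b * z\<^sup>2"
      by (simp add: power2_eq_square algebra_simps)
    ultimately have "x\<^sup>2 + a * y\<^sup>2 = p * (p * q - b * z\<^sup>2)" by linarith
    then have "p dvd x \<and> p dvd y" using aniso by (metis dvd_triv_left)
    then obtain x' y' where xy: "x = p * x'" "y = p * y'" by (auto elim!: dvdE)
    have "p * (p * (q - x'\<^sup>2 - a * y'\<^sup>2)) = p\<^sup>2 * q - x\<^sup>2 - a * y\<^sup>2"
      unfolding xy by (simp add: power2_eq_square algebra_simps)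
    also have "\<dots> = p * (b * z\<^sup>2)"
      unfolding eq[symmetric] by simp
    finally have bz: "p * (q - x'\<^sup>2 - a * y'\<^sup>2) = b * z\<^sup>2" using p0 by (metis mult_left_cancel)
    then have "p dvd b * z\<^sup>2" by (metis dvd_triv_left)
    then have "p dvd z" using b p by (metis prime_dvd_mult_iff prime_dvd_power)
    then obtain z' where z: "z = p * z'" by (auto elim!: dvdE)
    have "p * (p * b * z'\<^sup>2) = b * z\<^sup>2"
      unfolding z by (simp add: power2_eq_square)
    then have "p * b * z'\<^sup>2 = q - x'\<^sup>2 - a * y'\<^sup>2" using p0 bz by (metis mult_left_cancel)
    then have "x'\<^sup>2 + a * y'\<^sup>2 + p * b * z'\<^sup>2 = p ^ (2 * e + 1) * t"
      unfolding q_def by simp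
    then show ?case by (rule Suc.IH)
  qed
  obtain s n where s: "s > 0" and rep: "\<forall>m\<ge>n. \<exists>x y z. x\<^sup>2 + a * y\<^sup>2 + (p * b) * z\<^sup>2 = s * m"
    using rep unfolding represents_multiples_def by blast
  obtain j s' where s': "s = p ^ j * s'" "\<not> p dvd s'"
    using s p multiplicity_decompose'[of s p]
    by (metis less_irrefl not_prime_unit)
  obtain w where w: "p dvd w * s' - 1" using inv s'(2) by blast
  \<comment> \<open>As \<open>w\<close> inverts \<open>s'\<close> modulo \<open>p\<close>, this
    makes \<open>s' * m'\<close> congruent to \<open>-a * b\<close>, and \<open>K\<close> lifts
    \<open>m'\<close> above the threshold. The factor \<open>p^(j+1)\<close> used below completes
    the \<open>p^j\<close> in \<open>s\<close> to the odd power \<open>p^(2j+1)\<close>.\<close>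
  define K where "K = \<bar>n\<bar> + \<bar>w * a * b\<bar>"
  define m' where "m' = p * K - w * a * b"
  have p1: "p \<ge> 1" using p prime_ge_1_int by blast
  have K: "K \<ge> 0" "K \<ge> w * a * b" "K \<ge> n + w * a * b" unfolding K_def by linarith+
  have "1 * K \<le> p * K" using p1 K(1) by (intro mult_right_mono) auto
  then have m': "m' \<ge> n" "m' \<ge> 0" unfolding m'_def using K by linarith+
  have "1 * m' \<le> p ^ (j + 1) * m'"
    using p1 m' by (intro mult_right_mono one_le_power) auto
  then have "p ^ (j + 1) * m' \<ge> n" using m' by linarith
  then obtain x y z where "x\<^sup>2 + a * y\<^sup>2 + (p * b) * z\<^sup>2 = s * (p ^ (j + 1) * m')"
    using rep by blast
  also have "\<dots> = (p ^ j * p ^ j * p) * (s' * m')"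
    by (simp add: s')
  also have "p ^ j * p ^ j * p = p ^ (2 * j + 1)"
    by (simp add: power_add mult_2)
  finally have "\<exists>z. p dvd s' * m' - b * z\<^sup>2" by (rule descent)
  then obtain z where z: "p dvd s' * m' - b * z\<^sup>2" by blast
  have "b * (z\<^sup>2 + a) = p * (s' * K) - (s' * m' - b * z\<^sup>2) - a * b * (w * s' - 1)"
    unfolding m'_def by (simp add: algebra_simps)
  moreover have "p dvd p * (s' * K) - (s' * m' - b * z\<^sup>2) - a * b * (w * s' - 1)"
    by (intro dvd_diff dvd_triv_left z dvd_mult[OF w])
  ultimately have "p dvd b * (z\<^sup>2 + a)" by simp
  then have "p dvd b \<or> p dvd z\<^sup>2 + a" using p by (simp only: prime_dvd_mult_iff)
  then show False using b nres by blast
qed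

section \<open>Square roots of \<open>-a\<close> modulo squarefree numbers\<close>

lemma squarefree_prime_mult_not_dvd:
  fixes p c :: "'a::factorial_semiring"
  assumes "prime p" "squarefree (p * c)"
  shows "\<not> p dvd c"
proof
  assume "p dvd c"
  then have "p\<^sup>2 dvd p * c" unfolding power2_eq_square by (rule mult_dvd_mono[OF dvd_refl])
  then have "is_unit p" using assms(2) squarefreeD by blast
  then show False using assms(1) not_prime_unit by blast
qed

text \<open>One prime is split off at a time; it is coprime to the cofactor, so the Chinese
  remainder theorem glues the two roots.\<close>

lemma squarefree_dvd_square_plus:
  fixes a b :: int
  assumes "b > 0" "squarefree b" "\<And>p. prime p \<Longrightarrow> p dvd b \<Longrightarrow> \<exists>t. p dvd t\<^sup>2 + a"
  shows "\<exists>t. b dvd t\<^sup>2 + a"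
  using assms
proof (induction "nat b" arbitrary: b rule: less_induct)
  case less
  show ?case
  proof (cases "b = 1")
    case False
    then have "\<not> is_unit b" "b \<noteq> 0" using less.prems by auto
    then obtain p where p: "prime p" "p dvd b" using prime_divisor_exists by blast
    then obtain c where c: "b = p * c" by blast
    have p1: "p > 1" using p(1) prime_gt_1_int by blast
    have c0: "c > 0" using c less.prems(1) p1 by (metis zero_less_mult_pos zero_less_one less_trans)
    have "\<not> p dvd c"
      using less.prems(2) p(1) unfolding c by (intro squarefree_prime_mult_not_dvd)
    then have cop: "coprime p c" using p(1) prime_imp_coprime by blast
    have "nat c < nat b" using c c0 p1 by simp
    moreover have "squarefree c" using less.prems(2) c squarefree_mono by (metis dvd_triv_right)
    moreover have "\<exists>t. q dvd t\<^sup>2 + a" if "prime q" "q dvd c" for q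
      using less.prems(3) that c by simp
    ultimately obtain t2 where t2: "c dvd t2\<^sup>2 + a" using less.hyps c0 by blast
    obtain t1 where t1: "p dvd t1\<^sup>2 + a" using less.prems(3) p by blast
    obtain t where t: "[t = t1] (mod p)" "[t = t2] (mod c)"
      using binary_chinese_remainder_int[OF cop] by blast
    have "[t\<^sup>2 + a = t1\<^sup>2 + a] (mod p)" "[t\<^sup>2 + a = t2\<^sup>2 + a] (mod c)"
      using t by (auto intro: cong_add cong_pow)
    then have "p dvd t\<^sup>2 + a" "c dvd t\<^sup>2 + a" using t1 t2 cong_dvd_iff by blast+
    then show ?thesis unfolding c using cop divides_mult by blast
  qed simp
qed

section \<open>Sums of three squares\<close>

lemma square_mod_8: "(x::int)\<^sup>2 mod 8 = (if even x then (if 4 dvd x then 0 else 4) else 1)"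
proof -
  have "x\<^sup>2 mod 8 = (x mod 8)\<^sup>2 mod 8" by (simp add: power_mod)
  moreover have "x mod 8 \<in> {0,1,2,3,4,5,6,7}"
    using pos_mod_bound[of 8 x] pos_mod_sign[of 8 x] by auto
  moreover have "even x \<longleftrightarrow> even (x mod 8)" "4 dvd x \<longleftrightarrow> 4 dvd x mod 8"
    by presburger+
  ultimately show ?thesis by auto
qed

lemma not_represents_multiples_1_1: "\<not> represents_multiples 1 1"
proof
  assume "represents_multiples 1 1"
  then obtain s n where s: "s > 0" and rep: "\<forall>m\<ge>n. \<exists>x y z :: int. x\<^sup>2 + y\<^sup>2 + z\<^sup>2 = s * m"
    unfolding represents_multiples_def mult_1 by blast
  have mod8: "(i + j + k) mod 8 = (i mod 8 + j mod 8 + k mod 8) mod 8" for i j k :: int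
    unfolding cong_def[symmetric] by (intro cong_add) (simp_all add: cong_def)
  have descent: "t mod 8 \<noteq> 7" if "x\<^sup>2 + y\<^sup>2 + z\<^sup>2 = 4 ^ e * t" for x y z t :: int and e
    using that
  proof (induction e arbitrary: x y z)
    case (0 x y z)
    have "(x\<^sup>2 + y\<^sup>2 + z\<^sup>2) mod 8 = (x\<^sup>2 mod 8 + y\<^sup>2 mod 8 + z\<^sup>2 mod 8) mod 8"
      using mod8[of "x\<^sup>2"] by blast
    moreover have "x\<^sup>2 + y\<^sup>2 + z\<^sup>2 = t" using 0 by simp
    ultimately have "t mod 8 = (x\<^sup>2 mod 8 + y\<^sup>2 mod 8 + z\<^sup>2 mod 8) mod 8"
      by metis
    then show ?case unfolding square_mod_8 by (auto split: if_splits)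
  next
    case (Suc e)
    \<comment> \<open>Squares are 0 or 1 modulo 4, so a sum of three divisible by 4 has only even
      terms and a factor 4 cancels.\<close>
    have "(x\<^sup>2 + y\<^sup>2 + z\<^sup>2) mod 8 mod 4 = (x\<^sup>2 + y\<^sup>2 + z\<^sup>2) mod 4"
      by (rule mod_mod_cancel) simp
    moreover have "(x\<^sup>2 + y\<^sup>2 + z\<^sup>2) mod 4 = 0" using Suc.prems by simp
    ultimately have "(x\<^sup>2 mod 8 + y\<^sup>2 mod 8 + z\<^sup>2 mod 8) mod 8 mod 4 = 0"
      unfolding mod8[of "x\<^sup>2"] by simp
    then have "even x \<and> even y \<and> even z"
      unfolding square_mod_8 by (auto split: if_splits)
    then obtain x' y' z' where "x = 2 * x'" "y = 2 * y'" "z = 2 * z'" by (auto elim!: evenE)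
    then have "x'\<^sup>2 + y'\<^sup>2 + z'\<^sup>2 = 4 ^ e * t" using Suc.prems by (simp add: power_mult_distrib)
    then show ?case by (rule Suc.IH)
  qed
  obtain j s' where s': "s = 2 ^ j * s'" "odd s'"
    using s multiplicity_decompose'[of s 2] by (metis less_irrefl odd_one)
  have "(s' * s') mod 8 = 1" using square_mod_8[of s'] s'(2) by (simp add: power2_eq_square)
  then obtain k where k: "s' * s' = 8 * k + 1"
    by (metis mult_div_mod_eq)
  \<comment> \<open>Since \<open>s'\<close> is odd, \<open>s' * s'\<close> is 1 modulo 8, so
    \<open>m'\<close> congruent to \<open>-s'\<close> gives \<open>s' * m'\<close> congruent to 7.
    The extra factor \<open>2^j\<close> turns the power of 2 in \<open>s\<close> into
    \<open>4^j\<close>.\<close>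
  define K where "K = \<bar>n\<bar> + \<bar>s'\<bar>"
  define m' where "m' = 8 * K - s'"
  have "K \<ge> 0" "K \<ge> s'" "K \<ge> n + s'" unfolding K_def by linarith+
  then have m': "m' \<ge> n" "m' \<ge> 0" unfolding m'_def by linarith+
  have "1 * m' \<le> 2 ^ j * m'" using m' by (intro mult_right_mono one_le_power) auto
  then have "2 ^ j * m' \<ge> n" using m' by linarith
  then obtain x y z where "x\<^sup>2 + y\<^sup>2 + z\<^sup>2 = s * (2 ^ j * m')" using rep by blast
  also have "\<dots> = 4 ^ j * (s' * m')"
    by (simp add: s' power_mult_distrib[symmetric])
  finally have "(s' * m') mod 8 \<noteq> 7" by (rule descent)
  moreover have "s' * m' = 7 + 8 * (s' * K - k - 1)"
    using k by (simp add: m'_def algebra_simps)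
  then have "(s' * m') mod 8 = 7" by presburger
  ultimately show False by simp
qed

section \<open>Legendre descent for ternary forms\<close>

theorem not_represents_multiples:
  assumes "a > 0" "b > 0"
  shows "\<not> represents_multiples a b"
  using assms
proof (induction "nat (a + b)" arbitrary: a b rule: less_induct)
  case less
  \<comment> \<open>The induction hypothesis is a premise here so that the claim also applies with
    the two coefficients exchanged.\<close>
  have ordered: "\<not> represents_multiples a b"
    if "0 < a" "a \<le> b"
      and IH: "\<And>c d. nat (c + d) < nat (a + b) \<Longrightarrow> 0 < c \<Longrightarrow> 0 < d \<Longrightarrow> \<not> represents_multiples c d" for a b
  proof
    assume rep: "represents_multiples a b"
    consider "b = 1" | "\<not> squarefree b" | "b > 1" "squarefree b" using \<open>0 < a\<close> \<open>a \<le> b\<close> by fastforce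
    then show False
    proof cases
      case 1
      then have "a = 1" using that by simp
      with 1 show ?thesis using rep not_represents_multiples_1_1 by simp
    next
      case 2
      then obtain k c where k: "b = k\<^sup>2 * c" "\<not> is_unit k"
        by (auto elim!: not_squarefreeE)
      have "k\<^sup>2 * c > 0" using k(1) that by simp
      then have "k\<^sup>2 > 0" "c > 0" by (auto simp: zero_less_mult_iff)
      moreover have "k\<^sup>2 \<noteq> 1" using k(2) by (auto simp: power2_eq_1_iff)
      ultimately have "1 < k\<^sup>2" by linarith
      then have "c < b" unfolding k(1) using \<open>c > 0\<close> by simp
      moreover have "represents_multiples a c"
        using rep unfolding k(1) by (rule represents_multiples_square)
      ultimately show ?thesis using IH[of a c] that \<open>c > 0\<close> by auto
    next
      case 3
      have "\<exists>t. p dvd t\<^sup>2 + a" if p: "prime p" "p dvd b" for p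
      proof -
        obtain c where c: "b = p * c" using p by blast
        have "\<not> p dvd c"
          using 3 p(1) unfolding c by (intro squarefree_prime_mult_not_dvd)
        then show ?thesis using prime_dvd_square_plus p rep c by blast
      qed
      then obtain t0 where t0: "b dvd t0\<^sup>2 + a"
        using squarefree_dvd_square_plus[of b a] 3 by auto
      define t where "t = t0 mod b"
      have t: "0 \<le> t" "t \<le> b - 1" unfolding t_def using 3 pos_mod_bound[of b t0] by auto
      have "[t\<^sup>2 + a = t0\<^sup>2 + a] (mod b)"
        unfolding t_def by (intro cong_add cong_pow) (auto simp: cong_def)
      then have "b dvd t\<^sup>2 + a" using t0 cong_dvd_iff by blast
      then obtain c where c: "t\<^sup>2 + a = b * c" by blast
      have pos: "b * c > 0" unfolding c[symmetric] using that by (simp add: add_nonneg_pos)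
      then have c0: "c > 0" using 3 by (simp add: zero_less_mult_iff)
      \<comment> \<open>Here \<open>a <= b\<close> and \<open>b > 1\<close> enter:
        \<open>b * c = t^2 + a <= (b - 1)^2 + b < b^2\<close>, so the new coefficient is
        smaller.\<close>
      have "t\<^sup>2 \<le> (b - 1)\<^sup>2" using t by (intro power_mono)
      then have "b * c \<le> (b - 1)\<^sup>2 + b" using c that by linarith
      also have "\<dots> < b * b" using 3 by (simp add: power2_eq_square algebra_simps)
      finally have "c < b" using 3 by simp
      moreover have "represents_multiples a c" using rep c pos by (rule represents_multiples_norm)
      ultimately show ?thesis using IH[of a c] that c0 by auto
    qed
  qed
  show ?case
  proof (cases "a \<le> b")
    case True
    then show ?thesis using ordered less by blast
  next
    case False
    have "\<not> represents_multiples b a"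
      by (rule ordered) (use False less in \<open>auto simp: add.commute\<close>)
    then show ?thesis using represents_multiples_commute by blast
  qed
qed

section \<open>Sums of four squares\<close>

definition sum_of_four_squares :: "int \<Rightarrow> bool" where
  "sum_of_four_squares n \<longleftrightarrow> (\<exists>a b c d. n = a\<^sup>2 + b\<^sup>2 + c\<^sup>2 + d\<^sup>2)"

text \<open>Euler's identity, the multiplicativity of the quaternion norm.\<close>

lemma sum_of_four_squares_mult:
  assumes "sum_of_four_squares m" "sum_of_four_squares n"
  shows "sum_of_four_squares (m * n)"
proof -
  obtain a b c d where m: "m = a\<^sup>2 + b\<^sup>2 + c\<^sup>2 + d\<^sup>2"
    using assms(1) unfolding sum_of_four_squares_def by blast
  obtain e f g h where n: "n = e\<^sup>2 + f\<^sup>2 + g\<^sup>2 + h\<^sup>2"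
    using assms(2) unfolding sum_of_four_squares_def by blast
  have "m * n = (a*e + b*f + c*g + d*h)\<^sup>2 + (a*f - b*e + c*h - d*g)\<^sup>2
      + (a*g - b*h - c*e + d*f)\<^sup>2 + (a*h + b*g - c*f - d*e)\<^sup>2"
    unfolding m n by (simp add: power2_eq_square algebra_simps)
  then show ?thesis unfolding sum_of_four_squares_def by blast
qed

text \<open>Pigeonhole: for \<open>p = 2 * h + 1\<close> the residues \<open>x^2\<close> and
  \<open>-1 - y^2\<close> with arguments in \<open>{0..h}\<close> form two sets of size
  \<open>h + 1\<close>, which must meet. The small arguments keep \<open>k\<close> below
  \<open>p\<close>.\<close>

lemma prime_dvd_sum_two_squares_plus_one:
  fixes p :: int
  assumes "prime p"
  obtains x y k where "x\<^sup>2 + y\<^sup>2 + 1 = k * p" "0 < k" "k < p"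
proof (cases "p = 2")
  case True
  then show ?thesis using that[of 1 0 1] by simp
next
  case False
  then have "odd p" using assms primes_dvd_imp_eq two_is_prime by blast
  then obtain h where h: "p = 2 * h + 1" by (auto elim!: oddE)
  have h0: "h > 0" using h prime_gt_1_int[OF assms] by simp
  have inj: "x = y" if "x \<in> {0..h}" "y \<in> {0..h}" "p dvd x\<^sup>2 - y\<^sup>2" for x y
  proof -
    have "p dvd (x + y) * (x - y)" using that(3) by (simp add: power2_eq_square algebra_simps)
    then consider "p dvd x + y" | "p dvd x - y" using assms prime_dvd_mult_iff by blast
    then show ?thesis
    proof cases
      case 1
      then have "x + y = 0" using that h zdvd_not_zless[of "x + y" p] by force
      then show ?thesis using that by simp
    next
      case 2
      then show ?thesis using that h dvd_imp_le_int[of "x - y" p] by fastforce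
    qed
  qed
  define f where "f x = x\<^sup>2 mod p" for x
  define g where "g y = (- 1 - y\<^sup>2) mod p" for y
  have "inj_on f {0..h}"
    by (rule inj_onI) (auto simp: f_def mod_eq_dvd_iff intro: inj)
  then have cf: "card (f ` {0..h}) = nat (h + 1)" by (simp add: card_image)
  have "inj_on g {0..h}"
    by (rule inj_onI) (auto simp: g_def mod_eq_dvd_iff dvd_diff_commute intro: inj)
  then have cg: "card (g ` {0..h}) = nat (h + 1)" by (simp add: card_image)
  have sub: "f ` {0..h} \<union> g ` {0..h} \<subseteq> {0..<p}"
    using prime_gt_0_int[OF assms] by (auto simp: f_def g_def)
  have "f ` {0..h} \<inter> g ` {0..h} \<noteq> {}"
  proof
    assume "f ` {0..h} \<inter> g ` {0..h} = {}"
    then have "card (f ` {0..h} \<union> g ` {0..h}) = 2 * nat (h + 1)"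
      by (simp add: card_Un_disjoint cf cg)
    moreover have "card (f ` {0..h} \<union> g ` {0..h}) \<le> nat p"
      using card_mono[OF _ sub] by simp
    ultimately show False using h h0 by simp
  qed
  then obtain x y where xy: "x \<in> {0..h}" "y \<in> {0..h}" "f x = g y" by blast
  have "p dvd x\<^sup>2 - (- 1 - y\<^sup>2)" using xy(3) by (simp add: f_def g_def mod_eq_dvd_iff)
  then have "p dvd x\<^sup>2 + y\<^sup>2 + 1" by (simp add: algebra_simps)
  then obtain k where k: "x\<^sup>2 + y\<^sup>2 + 1 = k * p" by (metis dvdE mult.commute)
  have "k * p > 0" unfolding k[symmetric] by (simp add: add_nonneg_pos)
  then have k0: "k > 0" using h h0 by (simp add: zero_less_mult_iff)
  have "x\<^sup>2 \<le> h\<^sup>2" "y\<^sup>2 \<le> h\<^sup>2" using xy by (auto intro!: power_mono)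
  moreover have "2 * h\<^sup>2 + 1 < p * p" using h h0 by (simp add: power2_eq_square algebra_simps add_pos_pos)
  ultimately have "k * p < p * p" unfolding k[symmetric] by linarith
  then have "k < p" using h h0 by simp
  with k k0 show ?thesis using that by blast
qed

text \<open>\<open>k\<close> is \<open>x / m\<close> rounded to a nearest integer, whence the
  remainder has absolute value at most \<open>m / 2\<close>.\<close>

lemma least_absolute_residue:
  fixes x m :: int
  assumes "m > 0"
  obtains y k where "x = y + m * k" "4 * y\<^sup>2 \<le> m\<^sup>2"
proof -
  define k where "k = (2 * x + m) div (2 * m)"
  have "2 * x + m = 2 * m * k + (2 * x + m) mod (2 * m)"
    unfolding k_def by simp
  moreover have "0 \<le> (2 * x + m) mod (2 * m)" "(2 * x + m) mod (2 * m) < 2 * m"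
    using assms by simp_all
  ultimately have "- m \<le> 2 * x - 2 * m * k" "2 * x - 2 * m * k \<le> m" by linarith+
  moreover have "2 * x - 2 * m * k = 2 * (x - m * k)" by simp
  ultimately have "\<bar>2 * (x - m * k)\<bar> \<le> \<bar>m\<bar>" by simp
  then have "(2 * (x - m * k))\<^sup>2 \<le> m\<^sup>2" by (simp only: abs_le_square_iff)
  then have "4 * (x - m * k)\<^sup>2 \<le> m\<^sup>2" unfolding power_mult_distrib by simp
  moreover have "x = (x - m * k) + m * k" by simp
  ultimately show ?thesis using that by blast
qed

text \<open>Reducing the four roots modulo \<open>m\<close> to least absolute residues gives
  \<open>m * r\<close>, a sum of four squares with \<open>r <= m\<close>. The extremes
  \<open>r = 0\<close> and \<open>r = m\<close> would make \<open>m\<close> divide \<open>p\<close>;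
  otherwise \<open>r\<close> replaces \<open>m\<close>.\<close>

lemma prime_sum_of_four_squares_descent:
  fixes p m :: int
  assumes "prime p" "0 < m" "m < p" "sum_of_four_squares (m * p)"
  shows "sum_of_four_squares p"
  using assms(2-4)
proof (induction "nat m" arbitrary: m rule: less_induct)
  case less
  show ?case
  proof (cases "m = 1")
    case False
    obtain x1 x2 x3 x4 where x: "m * p = x1\<^sup>2 + x2\<^sup>2 + x3\<^sup>2 + x4\<^sup>2"
      using less.prems unfolding sum_of_four_squares_def by blast
    obtain y1 k1 where 1: "x1 = y1 + m * k1" "4 * y1\<^sup>2 \<le> m\<^sup>2" using least_absolute_residue less.prems(1) .
    obtain y2 k2 where 2: "x2 = y2 + m * k2" "4 * y2\<^sup>2 \<le> m\<^sup>2" using least_absolute_residue less.prems(1) .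
    obtain y3 k3 where 3: "x3 = y3 + m * k3" "4 * y3\<^sup>2 \<le> m\<^sup>2" using least_absolute_residue less.prems(1) .
    obtain y4 k4 where 4: "x4 = y4 + m * k4" "4 * y4\<^sup>2 \<le> m\<^sup>2" using least_absolute_residue less.prems(1) .
    define S where "S = k1 * y1 + k2 * y2 + k3 * y3 + k4 * y4"
    define K where "K = k1\<^sup>2 + k2\<^sup>2 + k3\<^sup>2 + k4\<^sup>2"
    define r where "r = p - 2 * S - m * K"
    have mp: "m * p = (y1\<^sup>2 + y2\<^sup>2 + y3\<^sup>2 + y4\<^sup>2) + m * (2 * S + m * K)"
      unfolding x 1(1) 2(1) 3(1) 4(1) S_def K_def by (simp add: power2_eq_square algebra_simps)
    have mr: "m * r = y1\<^sup>2 + y2\<^sup>2 + y3\<^sup>2 + y4\<^sup>2"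
      using mp by (simp add: r_def right_diff_distrib distrib_left)
    have not_dvd: "\<not> m dvd p"
      using assms(1) less.prems(1,2) False zdvd_not_zless prime_int_iff by (metis less_irrefl order_less_imp_le)
    have "m * r \<ge> 0" unfolding mr by simp
    then have r0: "r \<ge> 0" using less.prems(1) by (simp add: zero_le_mult_iff)
    have "m * r \<le> m * m" unfolding mr power2_eq_square[symmetric] using 1 2 3 4 by linarith
    then have rm: "r \<le> m" using less.prems(1) by simp
    have "r \<noteq> 0"
    proof
      assume "r = 0"
      then have "y1\<^sup>2 + y2\<^sup>2 + y3\<^sup>2 + y4\<^sup>2 = 0" using mr by simp
      moreover have "y1\<^sup>2 \<ge> 0" "y2\<^sup>2 \<ge> 0" "y3\<^sup>2 \<ge> 0" "y4\<^sup>2 \<ge> 0" by simp_all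
      ultimately have "y1\<^sup>2 = 0" "y2\<^sup>2 = 0" "y3\<^sup>2 = 0" "y4\<^sup>2 = 0" by linarith+
      then have "S = 0" by (simp add: S_def)
      then have "p = m * K" using \<open>r = 0\<close> by (simp add: r_def)
      then show False using not_dvd by simp
    qed
    moreover have "r \<noteq> m"
    proof
      assume "r = m"
      then have "y1\<^sup>2 + y2\<^sup>2 + y3\<^sup>2 + y4\<^sup>2 = m\<^sup>2" using mr by (simp add: power2_eq_square)
      then have "4 * y1\<^sup>2 = m\<^sup>2" "4 * y2\<^sup>2 = m\<^sup>2" "4 * y3\<^sup>2 = m\<^sup>2" "4 * y4\<^sup>2 = m\<^sup>2"
        using 1 2 3 4 by linarith+
      then have "(2 * y1)\<^sup>2 = m\<^sup>2" "(2 * y2)\<^sup>2 = m\<^sup>2" "(2 * y3)\<^sup>2 = m\<^sup>2" "(2 * y4)\<^sup>2 = m\<^sup>2"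
        by (simp_all add: power_mult_distrib)
      then have "m dvd 2 * y1" "m dvd 2 * y2" "m dvd 2 * y3" "m dvd 2 * y4"
        by (metis dvd_refl power2_eq_iff dvd_minus_iff)+
      then have "m dvd k1 * (2 * y1) + k2 * (2 * y2) + k3 * (2 * y3) + k4 * (2 * y4)"
        by (simp only: dvd_add dvd_mult)
      also have "\<dots> = 2 * S" by (simp add: S_def algebra_simps)
      finally have "m dvd m + 2 * S + m * K" by simp
      moreover have "p = m + 2 * S + m * K" using \<open>r = m\<close> by (simp add: r_def)
      ultimately show False using not_dvd by simp
    qed
    moreover have "sum_of_four_squares (r * p)"
    proof -
      have "r * p = r\<^sup>2 + 2 * r * S + (m * r) * K"
        by (simp add: r_def power2_eq_square algebra_simps)
      \<comment> \<open>These are the four terms of Euler's identity for the \<open>x\<close> and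
        the \<open>y\<close>, divided by \<open>m\<close>: with \<open>x1 = y1 + m * k1\<close> and
        so on, the pure \<open>y\<close> parts cancel in the last three and sum to
        \<open>m * r\<close> in the first.\<close>
      also have "\<dots> = (r + S)\<^sup>2 + (k1*y2 - k2*y1 + k3*y4 - k4*y3)\<^sup>2
        + (k1*y3 - k2*y4 - k3*y1 + k4*y2)\<^sup>2 + (k1*y4 + k2*y3 - k3*y2 - k4*y1)\<^sup>2"
        unfolding mr S_def K_def by (simp add: power2_eq_square algebra_simps)
      finally show ?thesis unfolding sum_of_four_squares_def by blast
    qed
    ultimately show ?thesis using less.hyps[of r] r0 rm less.prems by auto
  qed (use less.prems in auto)
qed

theorem four_squares:
  assumes "(n::int) \<ge> 0"
  shows "sum_of_four_squares n"
  using assms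
proof (induction "nat n" arbitrary: n rule: less_induct)
  case less
  consider "n = 0" | "n = 1" | "n > 1" using less.prems by linarith
  then show ?case
  proof cases
    case 1
    then show ?thesis unfolding sum_of_four_squares_def by (intro exI[of _ 0]) simp
  next
    case 2
    then show ?thesis unfolding sum_of_four_squares_def
      by (intro exI[of _ 0] exI[of _ 1]) simp
  next
    case 3
    then have "\<not> is_unit n" by auto
    then obtain p where p: "prime p" "p dvd n" using prime_divisor_exists 3 by (metis not_one_less_zero)
    then obtain c where c: "n = p * c" by blast
    obtain x y k where k: "x\<^sup>2 + y\<^sup>2 + 1 = k * p" "0 < k" "k < p"
      using prime_dvd_sum_two_squares_plus_one p(1) .
    have "k * p = x\<^sup>2 + y\<^sup>2 + 1\<^sup>2 + 0\<^sup>2" using k(1) by simp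
    then have "sum_of_four_squares (k * p)" unfolding sum_of_four_squares_def by blast
    then have "sum_of_four_squares p" using prime_sum_of_four_squares_descent p(1) k by blast
    moreover have "p > 1" using p(1) prime_gt_1_int by blast
    then have "c > 0" using 3 c by (metis less_trans zero_less_mult_pos zero_less_one)
    then have "sum_of_four_squares c" using less.hyps[of c] c \<open>p > 1\<close> by simp
    ultimately show ?thesis unfolding c by (rule sum_of_four_squares_mult)
  qed
qed

section \<open>Integral lattices\<close>

lemma zscale_2: "zscale 2 x = x + x"
  using zmod.scale_left_distrib[of 1 1 x] by simp

lemma zscale_minus_1: "zscale (- 1) x = - x"
  by (simp add: zmod.scale_minus_left)

context
  fixes L :: "'a::ab_group_add set" and B :: "'a \<Rightarrow> 'a \<Rightarrow> int"
  assumes lattice: "z_lattice L B"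
begin

lemma z_lattice_closed:
  shows "0 \<in> L" "x \<in> L \<Longrightarrow> y \<in> L \<Longrightarrow> x + y \<in> L" "x \<in> L \<Longrightarrow> y \<in> L \<Longrightarrow> x - y \<in> L"
    "x \<in> L \<Longrightarrow> zscale k x \<in> L"
proof -
  obtain X where L: "L = zmod.span X"
    using lattice by (auto simp: z_lattice_def free_zmodule_of_rank_def)
  show "0 \<in> L" "x \<in> L \<Longrightarrow> y \<in> L \<Longrightarrow> x + y \<in> L" "x \<in> L \<Longrightarrow> y \<in> L \<Longrightarrow> x - y \<in> L"
    "x \<in> L \<Longrightarrow> zscale k x \<in> L"
    unfolding L by (rule zmod.span_zero zmod.span_add zmod.span_diff zmod.span_scale; assumption)+
qed

lemma z_lattice_pos: "x \<in> L \<Longrightarrow> x \<noteq> 0 \<Longrightarrow> 0 < B x x"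
  using lattice unfolding z_lattice_def by blast

lemma z_lattice_form:
  assumes "x \<in> L" "y \<in> L"
  shows "B x y = B y x" "B (zscale k x) y = k * B x y" "B x (zscale k y) = k * B x y"
    "z \<in> L \<Longrightarrow> B (x + z) y = B x y + B z y" "z \<in> L \<Longrightarrow> B x (y + z) = B x y + B x z"
    "z \<in> L \<Longrightarrow> B (x - z) y = B x y - B z y" "z \<in> L \<Longrightarrow> B x (y - z) = B x y - B x z"
proof -
  have 1: "\<forall>x\<in>L. \<forall>y\<in>L. B x y = B y x"
    using lattice unfolding z_lattice_def by (elim conjE)
  have 2: "\<forall>x\<in>L. \<forall>y\<in>L. \<forall>z\<in>L. B (x + y) z = B x z + B y z"
    using lattice unfolding z_lattice_def by (elim conjE)
  have 3: "\<forall>k. \<forall>x\<in>L. \<forall>y\<in>L. B (zscale k x) y = k * B x y"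
    using lattice unfolding z_lattice_def by (elim conjE)
  have sym: "\<And>u v. u \<in> L \<Longrightarrow> v \<in> L \<Longrightarrow> B u v = B v u"
    and add: "\<And>u v w. u \<in> L \<Longrightarrow> v \<in> L \<Longrightarrow> w \<in> L \<Longrightarrow> B (u + v) w = B u w + B v w"
    and scale: "\<And>k u v. u \<in> L \<Longrightarrow> v \<in> L \<Longrightarrow> B (zscale k u) v = k * B u v"
    using 1 2 3 by blast+
  have diff: "B (u - v) w = B u w - B v w" if "u \<in> L" "v \<in> L" "w \<in> L" for u v w
    using add[of "u - v" v w] that z_lattice_closed by simp
  show "B x y = B y x" "B (zscale k x) y = k * B x y"
    by (rule sym scale assms)+
  show "B x (zscale k y) = k * B x y"
    unfolding sym[OF assms(1) z_lattice_closed(4)[OF assms(2)]] sym[OF assms]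
    by (rule scale assms)+
  assume z: "z \<in> L"
  show "B (x + z) y = B x y + B z y" "B (x - z) y = B x y - B z y"
    by (rule add diff assms z)+
  show "B x (y + z) = B x y + B x z" "B x (y - z) = B x y - B x z"
    unfolding sym[OF assms(1) z_lattice_closed(2)[OF assms(2) z]] sym[OF assms] sym[OF assms(1) z]
      sym[OF assms(1) z_lattice_closed(3)[OF assms(2) z]]
    by (rule add diff assms z)+
qed

end

text \<open>\<open>B e e\<close> times the form that \<open>B\<close> induces on the projections to the orthogonal complement of \<open>e\<close>;
  the factor clears the denominators.\<close>

lemma z_lattice_orthogonal_complement_form:
  assumes X: "finite X" "e \<notin> X" "zmod.independent (insert e X)"
    and lattice: "z_lattice (zmod.span (insert e X)) B"
  shows "z_lattice (zmod.span X) (\<lambda>x y. B e e * B x y - B x e * B y e)"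
proof -
  note closed = z_lattice_closed[OF lattice] and form = z_lattice_form[OF lattice]
  have e: "e \<in> zmod.span (insert e X)" by (simp add: zmod.span_base)
  have sub: "x \<in> zmod.span (insert e X)" if "x \<in> zmod.span X" for x
    using that zmod.span_mono[of X "insert e X"] by blast
  have "e \<noteq> 0" using X(3) zmod.dependent_zero by blast
  then have A: "B e e > 0" using z_lattice_pos[OF lattice] e by blast
  have "0 < B e e * B y y - B y e * B y e" if y: "y \<in> zmod.span X" "y \<noteq> 0" for y
  proof -
    obtain u where u: "y = (\<Sum>x\<in>X. zscale (u x) x)"
      using y(1) zmod.span_finite[OF X(1)] by auto
    \<comment> \<open>\<open>B e e\<close> times the projection of \<open>y\<close> orthogonal to
      \<open>e\<close>. It is nonzero by independence, and its norm is \<open>B e e\<close> times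
      the quantity in question.\<close>
    define w where "w = zscale (B e e) y - zscale (B y e) e"
    have "w \<noteq> 0"
    proof
      assume "w = 0"
      define c where "c x = (if x = e then - B y e else B e e * u x)" for x
      have "(\<Sum>x\<in>insert e X. zscale (c x) x) = (\<Sum>x\<in>X. zscale (c x) x) + zscale (- B y e) e"
        using X by (simp add: c_def add.commute)
      also have "(\<Sum>x\<in>X. zscale (c x) x) = (\<Sum>x\<in>X. zscale (B e e * u x) x)"
        using X(2) by (intro sum.cong) (auto simp: c_def)
      also have "\<dots> + zscale (- B y e) e = w"
        unfolding w_def u by (simp add: zmod.scale_sum_right zmod.scale_minus_left)
      finally have "(\<Sum>x\<in>insert e X. zscale (c x) x) = 0" using \<open>w = 0\<close> by simp
      then have "c x = 0" if "x \<in> X" for x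
        using zmod.independentD[OF X(3) _ subset_refl, of c x] X(1) that by simp
      moreover have "c x = B e e * u x" if "x \<in> X" for x
        using that X(2) by (auto simp: c_def)
      ultimately have "u x = 0" if "x \<in> X" for x
        using that A by (metis less_irrefl mult_eq_0_iff)
      then show False using u y(2) by simp
    qed
    have y': "y \<in> zmod.span (insert e X)" using sub y by blast
    have "w \<in> zmod.span (insert e X)" unfolding w_def by (intro closed y' e)
    then have "0 < B w w" using \<open>w \<noteq> 0\<close> by (rule z_lattice_pos[OF lattice])
    also have "B w w = B e e * (B e e * B y y - B y e * B y e)
        - B y e * (B e e * B y e - B y e * B e e)"
      by (simp only: w_def form(2,3,6,7) form(1)[OF e y'] closed y' e)
    also have "\<dots> = B e e * (B e e * B y y - B y e * B y e)"
      by simp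
    finally show ?thesis by (rule zero_less_mult_pos) (rule A)
  qed
  moreover have "free_zmodule_of_rank (card X) (zmod.span X)"
    unfolding free_zmodule_of_rank_def using X zmod.independent_mono by blast
  moreover have "B e e * B x y - B x e * B y e = B e e * B y x - B y e * B x e"
    if "x \<in> zmod.span X" "y \<in> zmod.span X" for x y
    using form(1)[OF sub[OF that(1)] sub[OF that(2)]] by simp
  moreover have "B e e * B (x + y) z - B (x + y) e * B z e
      = (B e e * B x z - B x e * B z e) + (B e e * B y z - B y e * B z e)"
    if "x \<in> zmod.span X" "y \<in> zmod.span X" "z \<in> zmod.span X" for x y z
    by (simp only: form(4) sub that e) (simp add: algebra_simps)
  moreover have "B e e * B (zscale k x) y - B (zscale k x) e * B y e = k * (B e e * B x y - B x e * B y e)"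
    if "x \<in> zmod.span X" "y \<in> zmod.span X" for k x y
    by (simp only: form(2) sub that e) (simp add: algebra_simps)
  ultimately show ?thesis
    unfolding z_lattice_def by (intro conjI exI[of _ "card X"] ballI allI impI) auto
qed

text \<open>Gram-Schmidt without denominators, one basis vector at a time. The \<open>a i\<close>
  are positive even beyond the rank, so that forms of smaller rank can be padded.\<close>

lemma z_lattice_diagonal:
  assumes "finite X" "zmod.independent X" "z_lattice (zmod.span X) B"
  shows "\<exists>s>0. \<exists>a :: nat \<Rightarrow> int. (\<forall>i. 0 < a i) \<and>
           (\<forall>x\<in>zmod.span X. \<exists>u. s * B x x = (\<Sum>i<card X. a i * (u i)\<^sup>2))"
  using assms
proof (induction X arbitrary: B rule: finite_induct)
  case empty
  have "B 0 0 = 0" using z_lattice_form(2)[OF empty(2), of 0 0 0] by simp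
  then show ?case by (auto intro!: exI[of _ 1] exI[of _ "\<lambda>_. 1"])
next
  case (insert e X)
  note closed = z_lattice_closed[OF insert.prems(2)] and form = z_lattice_form[OF insert.prems(2)]
  define C where "C x y = B e e * B x y - B x e * B y e" for x y
  have "z_lattice (zmod.span X) C"
    unfolding C_def using insert.hyps insert.prems by (rule z_lattice_orthogonal_complement_form)
  moreover have "zmod.independent X" using insert.prems(1) zmod.independent_mono by blast
  ultimately obtain s a where s: "s > 0" and a: "\<forall>i. 0 < a i"
    and diag: "\<forall>x\<in>zmod.span X. \<exists>u. s * C x x = (\<Sum>i<card X. a i * (u i)\<^sup>2)"
    using insert.IH[of C] by auto
  have e: "e \<in> zmod.span (insert e X)" by (simp add: zmod.span_base)
  have "e \<noteq> 0" using insert.prems(1) zmod.dependent_zero by blast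
  then have A: "B e e > 0" using z_lattice_pos[OF insert.prems(2)] e by blast
  define a' where "a' i = (if i < card X then a i else s)" for i
  have "\<exists>u. (s * B e e) * B x x = (\<Sum>i<card (insert e X). a' i * (u i)\<^sup>2)"
    if x: "x \<in> zmod.span (insert e X)" for x
  proof -
    obtain k where k: "x - zscale k e \<in> zmod.span X" using x zmod.span_insert by blast
    obtain u where u: "s * C (x - zscale k e) (x - zscale k e) = (\<Sum>i<card X. a i * (u i)\<^sup>2)"
      using diag k by blast
    \<comment> \<open>\<open>C\<close> vanishes whenever one argument is \<open>e\<close>, so
      subtracting a multiple of \<open>e\<close> does not change it.\<close>
    have "C (x - zscale k e) (x - zscale k e) = B e e * B x x - B x e * B x e"
      unfolding C_def
      by (simp only: form(2,3,6,7) form(1)[OF e x] closed x e) (simp add: algebra_simps)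
    then have "B e e * B x x = C (x - zscale k e) (x - zscale k e) + (B x e)\<^sup>2"
      by (simp add: power2_eq_square)
    then have "(s * B e e) * B x x = (\<Sum>i<card X. a i * (u i)\<^sup>2) + s * (B x e)\<^sup>2"
      unfolding u[symmetric] by (simp add: mult.assoc distrib_left)
    also have "\<dots> = (\<Sum>i<Suc (card X). a' i * ((u(card X := B x e)) i)\<^sup>2)"
      by (simp add: a'_def)
    also have "Suc (card X) = card (insert e X)" using insert.hyps by simp
    finally show ?thesis by blast
  qed
  moreover have "s * B e e > 0" "\<forall>i. 0 < a' i" using s a A by (auto simp: a'_def)
  ultimately show ?case by blast
qed

text \<open>A class modulo \<open>2 L\<close> is encoded by the set of basis vectors with odd
  coefficient, so there are at most \<open>2 ^ card X\<close> classes.\<close>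

lemma congruent_mod_2:
  assumes X: "finite X" "zmod.independent X"
    and x: "x \<in> zmod.span X" and y: "y \<in> zmod.span X"
    and eq: "{b \<in> X. odd (zmod.representation X x b)} = {b \<in> X. odd (zmod.representation X y b)}"
  shows "\<exists>z\<in>zmod.span X. x = y + zscale 2 z"
proof -
  let ?r = "zmod.representation X (x - y)"
  have "even (?r b)" if "b \<in> X" for b
  proof -
    have "odd (zmod.representation X x b) \<longleftrightarrow> odd (zmod.representation X y b)"
      using eq that by blast
    then show ?thesis by (simp add: zmod.representation_diff[OF X(2) y x])
  qed
  then have even: "2 * (?r b div 2) = ?r b" if "b \<in> X" for b
    using that dvd_mult_div_cancel by blast
  define z where "z = (\<Sum>b\<in>X. zscale (?r b div 2) b)"
  have z: "z \<in> zmod.span X"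
    unfolding z_def by (intro zmod.span_sum zmod.span_scale zmod.span_base)
  have "x - y = (\<Sum>b\<in>X. zscale (?r b) b)"
    using zmod.sum_representation_eq[OF X(2) zmod.span_diff[OF x y] X(1)] by simp
  also have "\<dots> = zscale 2 z"
    unfolding z_def zmod.scale_sum_right by (intro sum.cong refl) (simp add: even)
  finally have "x = y + zscale 2 z" by (simp add: diff_eq_eq add.commute)
  then show ?thesis using z by blast
qed

section \<open>Ranks of tight universal lattices\<close>

lemma tight_universal_represents:
  assumes "tight_universal n L B" "n \<ge> 1" "m \<ge> int n"
  obtains x where "x \<in> L" "B x x = m"
proof -
  have "m \<in> {m. m \<noteq> 0 \<and> represents L B m}"
    using assms by (simp add: tight_universal_def T_set_def)
  then show ?thesis using that by (auto simp: represents_def)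
qed

lemma tight_universal_min:
  assumes "tight_universal n L B" "x \<in> L" "x \<noteq> 0"
  shows "int n \<le> B x x"
proof -
  have "0 < B x x" using assms z_lattice_pos by (auto simp: tight_universal_def)
  then have "B x x \<in> {m. m \<noteq> 0 \<and> represents L B m}"
    using assms(2) by (auto simp: represents_def)
  also have "\<dots> = T_set n" using assms(1) by (simp add: tight_universal_def)
  finally show ?thesis by (simp add: T_set_def)
qed

lemma tight_universal_rank_ge_4:
  assumes X: "finite X" "zmod.independent X" and tight: "tight_universal n (zmod.span X) B" and n: "n \<ge> 1"
  shows "card X \<ge> 4"
proof (rule ccontr)
  assume "\<not> card X \<ge> 4"
  then have r: "card X \<le> 3" by simp
  have "z_lattice (zmod.span X) B" using tight by (simp add: tight_universal_def)
  then obtain s a where s: "s > 0" and a: "\<forall>i. 0 < a i"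
    and diag: "\<forall>x\<in>zmod.span X. \<exists>u. s * B x x = (\<Sum>i<card X. a i * (u i)\<^sup>2)"
    using z_lattice_diagonal[OF X] by blast
  \<comment> \<open>Multiplying the diagonal form by \<open>a 0\<close> and absorbing
    \<open>a 0\<close> into the first variable makes the leading coefficient 1.\<close>
  have "\<exists>x y z. x\<^sup>2 + (a 0 * a 1) * y\<^sup>2 + (a 0 * a 2) * z\<^sup>2 = (a 0 * s) * m" if m: "m \<ge> int n" for m
  proof -
    obtain x where x: "x \<in> zmod.span X" "B x x = m"
      using tight_universal_represents tight n m .
    then obtain u where u: "s * m = (\<Sum>i<card X. a i * (u i)\<^sup>2)" using diag by blast
    define v where "v i = (if i < card X then u i else 0)" for i
    have "s * m = (\<Sum>i<card X. a i * (v i)\<^sup>2)" unfolding u by (simp add: v_def)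
    also have "\<dots> = (\<Sum>i<3. a i * (v i)\<^sup>2)"
      by (rule sum.mono_neutral_left) (use r in \<open>auto simp: v_def\<close>)
    also have "\<dots> = a 0 * (v 0)\<^sup>2 + a 1 * (v 1)\<^sup>2 + a 2 * (v 2)\<^sup>2"
      by (simp add: eval_nat_numeral)
    finally have "(a 0 * v 0)\<^sup>2 + (a 0 * a 1) * (v 1)\<^sup>2 + (a 0 * a 2) * (v 2)\<^sup>2 = a 0 * (s * m)"
      by (simp add: power2_eq_square algebra_simps)
    then show ?thesis by (metis mult.assoc)
  qed
  moreover have "a 0 * s > 0" using a s by simp
  ultimately have "represents_multiples (a 0 * a 1) (a 0 * a 2)"
    unfolding represents_multiples_def by blast
  then show False using not_represents_multiples a by simp
qed

text \<open>For \<open>x = v + w\<close> and \<open>y = v - w\<close> the norms have sum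
  \<open>2 * (B v v + B w w)\<close> and difference \<open>4 * B v w\<close>. If \<open>x\<close> is
  not \<open>y\<close> or \<open>-y\<close>, then \<open>v\<close> and \<open>w\<close> are nonzero
  and have norm at least \<open>n\<close>; a sum of exactly \<open>4 * n\<close> forces both norms
  to be \<open>n\<close>.\<close>

lemma congruent_mod_2_cases:
  assumes lattice: "z_lattice L B" and min: "\<And>x. x \<in> L \<Longrightarrow> x \<noteq> 0 \<Longrightarrow> n \<le> B x x"
    and x: "x \<in> L" and y: "y \<in> L" and w: "w \<in> L" "x = y + zscale 2 w"
  obtains "x = y \<or> x = - y"
  | v where "4 dvd B x x - B y y" "B x x + B y y \<ge> 4 * n" "v \<in> L" "x = v + w" "y = v - w"
      "B x x + B y y = 4 * n \<longrightarrow> B v v = n \<and> B w w = n"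
proof (cases "x = y \<or> x = - y")
  case False
  note form = z_lattice_form[OF lattice]
  define v where "v = y + w"
  have v: "v \<in> L" unfolding v_def using z_lattice_closed[OF lattice] y w by blast
  have xy: "x = v + w" "y = v - w" by (simp_all add: v_def w(2) zscale_2)
  have "w \<noteq> 0" "v \<noteq> 0" using False xy by auto
  then have ge: "n \<le> B v v" "n \<le> B w w" using min v w by auto
  have Bx: "B x x = B v v + 2 * B v w + B w w"
    unfolding xy(1) using form(1)[OF w(1) v]
    by (simp only: form(4,5) z_lattice_closed[OF lattice] v w)
  have By: "B y y = B v v - 2 * B v w + B w w"
    unfolding xy(2) using form(1)[OF w(1) v]
    by (simp only: form(6,7) z_lattice_closed[OF lattice] v w)
  show ?thesis
  proof (rule that(2)[OF _ _ v xy])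
    have "B x x - B y y = 4 * B v w" using Bx By by simp
    then show "4 dvd B x x - B y y" by simp
    show "B x x + B y y \<ge> 4 * n" "B x x + B y y = 4 * n \<longrightarrow> B v v = n \<and> B w w = n"
      using ge Bx By by auto
  qed
qed (use that in blast)

lemma pairwise_incongruent_card:
  fixes f :: "nat \<Rightarrow> 'a::ab_group_add"
  assumes X: "finite X" "zmod.independent X"
    and f: "\<And>i. i < k \<Longrightarrow> f i \<in> zmod.span X"
    and inj: "\<And>i j w. i < k \<Longrightarrow> j < k \<Longrightarrow> w \<in> zmod.span X \<Longrightarrow> f i = f j + zscale 2 w \<Longrightarrow> i = j"
  shows "k \<le> 2 ^ card X"
proof -
  define g where "g x = {b \<in> X. odd (zmod.representation X x b)}" for x
  have "inj_on (\<lambda>i. g (f i)) {..<k}"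
  proof (rule inj_onI)
    fix i j assume ij: "i \<in> {..<k}" "j \<in> {..<k}" "g (f i) = g (f j)"
    then obtain w where "w \<in> zmod.span X" "f i = f j + zscale 2 w"
      using congruent_mod_2[OF X f f, of i j] unfolding g_def by auto
    then show "i = j" using inj ij by simp
  qed
  then have "card {..<k} \<le> card (Pow X)"
    by (rule card_inj_on_le) (use X in \<open>auto simp: g_def\<close>)
  then show ?thesis using X by (simp add: card_Pow)
qed

text \<open>Vectors \<open>V (n + i)\<close> of norm \<open>n + i\<close>, for \<open>i \<le> n + 2\<close>, and \<open>0\<close> are incongruent modulo \<open>2 L\<close>,
  except that \<open>V (2 n + 2)\<close> and \<open>V (2 n - 2)\<close> can be the sum and the difference of two vectors of
  norm \<open>n\<close>. In that case one of the latter replaces \<open>V (2 n + 2)\<close>.\<close>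

lemma tight_universal_rank_bound:
  assumes X: "finite X" "zmod.independent X" and tight: "tight_universal n (zmod.span X) B" and n: "n \<ge> 1"
  shows "n + 4 \<le> 2 ^ card X"
proof (cases "n = 1")
  case True
  \<comment> \<open>The norm comparison below needs \<open>n + (2 * n + 1) < 4 * n\<close>, which
    fails for \<open>n = 1\<close>; there rank 4 suffices.\<close>
  have "(2::nat) ^ 4 \<le> 2 ^ card X"
    using tight_universal_rank_ge_4[OF assms] by (intro power_increasing) auto
  then show ?thesis using True by simp
next
  case False
  then have n2: "n \<ge> 2" using n by simp
  let ?L = "zmod.span X"
  have lattice: "z_lattice ?L B" using tight by (simp add: tight_universal_def)
  have min: "int n \<le> B x x" if "x \<in> ?L" "x \<noteq> 0" for x
    using tight_universal_min[OF tight that] .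
  have B0: "B 0 0 = 0"
    using z_lattice_form(2)[OF lattice zmod.span_zero zmod.span_zero, of 0] by simp
  have Bneg: "B (- x) (- x) = B x x" if "x \<in> ?L" for x
    using z_lattice_form(2)[OF lattice that z_lattice_closed(4)[OF lattice that], of "-1" "-1"]
      z_lattice_form(3)[OF lattice that that, of "-1"]
    by (simp add: zscale_minus_1)
  have "\<exists>x. x \<in> ?L \<and> B x x = int m" if "m \<ge> n" for m
    using tight_universal_represents[OF tight n, of "int m"] that by auto
  then obtain V where V: "\<And>m. m \<ge> n \<Longrightarrow> V m \<in> ?L" "\<And>m. m \<ge> n \<Longrightarrow> B (V m) (V m) = int m"
    by metis
  show ?thesis
  proof (cases "\<exists>u v. u \<in> ?L \<and> v \<in> ?L \<and> B u u = int n \<and> B v v = int n \<and> u \<noteq> v \<and> u \<noteq> - v")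
    case True
    then obtain u v where uv: "u \<in> ?L" "v \<in> ?L" "B u u = int n" "B v v = int n" "u \<noteq> v" "u \<noteq> - v"
      by blast
    \<comment> \<open>Indices 1 to \<open>n + 1\<close> carry the norms \<open>n + 1\<close> to
      \<open>2 * n + 1\<close>; the second vector \<open>v\<close> of norm \<open>n\<close> stands
      in for norm \<open>2 * n + 2\<close>.\<close>
    define f where "f i = (if i = 0 then u else if i = n + 2 then v else if i = n + 3 then 0 else V (n + i))" for i
    have f: "f 0 = u" "f (n + 2) = v" by (simp_all add: f_def)
    have fL: "f i \<in> ?L" for i using uv V(1) by (simp add: f_def zmod.span_zero)
    have Q: "B (f i) (f i) = (if i = n + 2 then int n else if i = n + 3 then 0 else int (n + i))" for i
      using uv V(2) n B0 by (simp add: f_def)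
    show ?thesis
    proof (rule pairwise_incongruent_card[OF X])
      fix i j w assume ij: "i < n + 4" "j < n + 4" and w: "w \<in> ?L" "f i = f j + zscale 2 w"
      show "i = j"
      proof (rule congruent_mod_2_cases[OF lattice min fL[of i] fL[of j] w])
        assume eq: "f i = f j \<or> f i = - f j"
        then have "B (f i) (f i) = B (f j) (f j)" using Bneg[OF fL] by auto
        moreover have "\<not> (i = 0 \<and> j = n + 2)" "\<not> (i = n + 2 \<and> j = 0)"
          using eq uv(5,6) f by (metis minus_minus)+
        ultimately show "i = j" using ij n2 unfolding Q by (auto split: if_splits)
      next
        fix v assume d: "4 dvd B (f i) (f i) - B (f j) (f j)"
          and ge: "B (f i) (f i) + B (f j) (f j) \<ge> 4 * int n"
        have le: "i \<le> n + 1" "j \<le> n + 1"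
          using ge ij n2 unfolding Q by (auto split: if_splits)
        then have "B (f i) (f i) = int (n + i)" "B (f j) (f j) = int (n + j)" by (simp_all add: Q)
        \<comment> \<open>Both indices lie between \<open>n - 1\<close> and \<open>n + 1\<close>, so
          they differ by at most 2.\<close>
        then have "4 dvd int i - int j" "i + j \<ge> 2 * n" using d ge by simp_all
        then show "i = j" using le by presburger
      qed
    qed (rule fL)
  next
    case False
    then have unique: "u = v \<or> u = - v"
      if "u \<in> ?L" "v \<in> ?L" "B u u = int n \<and> B v v = int n" for u v
      using that by auto
    define f where "f i = (if i = n + 3 then 0 else V (n + i))" for i
    have fL: "f i \<in> ?L" for i using V(1) by (simp add: f_def zmod.span_zero)
    have Q: "B (f i) (f i) = (if i = n + 3 then 0 else int (n + i))" for i
      using V(2) B0 by (simp add: f_def)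
    show ?thesis
    proof (rule pairwise_incongruent_card[OF X])
      fix i j w assume ij: "i < n + 4" "j < n + 4" and w: "w \<in> ?L" "f i = f j + zscale 2 w"
      show "i = j"
      proof (rule congruent_mod_2_cases[OF lattice min fL[of i] fL[of j] w])
        assume "f i = f j \<or> f i = - f j"
        then have "B (f i) (f i) = B (f j) (f j)" using Bneg[OF fL] by auto
        then show "i = j" using ij n2 unfolding Q by (auto split: if_splits)
      next
        fix v
        assume d: "4 dvd B (f i) (f i) - B (f j) (f j)" and ge: "B (f i) (f i) + B (f j) (f j) \<ge> 4 * int n"
          and v: "v \<in> ?L" "f i = v + w" "f j = v - w"
          and eq: "B (f i) (f i) + B (f j) (f j) = 4 * int n \<longrightarrow> B v v = int n \<and> B w w = int n"
        \<comment> \<open>Equality would make \<open>v\<close> and \<open>w\<close> vectors of norm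
          \<open>n\<close>, hence equal up to sign, and one of \<open>f i\<close>,
          \<open>f j\<close> zero; but \<open>2 * n + 2 < 4 * n\<close>.\<close>
        have "B (f i) (f i) + B (f j) (f j) \<noteq> 4 * int n"
        proof
          assume "B (f i) (f i) + B (f j) (f j) = 4 * int n"
          then have "B v v = int n \<and> B w w = int n" by (rule mp[OF eq])
          then have "v = w \<or> v = - w"
            using v(1) w(1) by (intro unique)
          then have "f i = 0 \<or> f j = 0" unfolding v(2,3) by auto
          then have "B (f i) (f i) = 0 \<or> B (f j) (f j) = 0" using B0 by auto
          then show False using ge ij n2 unfolding Q by (auto split: if_splits)
        qed
        then have gt: "B (f i) (f i) + B (f j) (f j) > 4 * int n" using ge by linarith
        have le: "i \<le> n + 2" "j \<le> n + 2"
          using gt ij n2 unfolding Q by (auto split: if_splits)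
        then have "B (f i) (f i) = int (n + i)" "B (f j) (f j) = int (n + j)" by (simp_all add: Q)
        \<comment> \<open>Strictness leaves only indices from \<open>n - 1\<close> to
          \<open>n + 2\<close>, which differ by at most 3; it excludes the pair
          \<open>n - 2\<close>, \<open>n + 2\<close>.\<close>
        then have "4 dvd int i - int j" "i + j > 2 * n" using d gt by simp_all
        then show "i = j" using le by presburger
      qed
    qed (rule fL)
  qed
qed

text \<open>The diagonal form \<open>\<langle>n, n + 1, \<dots>, 2 n - 1, n, n, n, n\<rangle>\<close>.\<close>

lemma ex_tight_rank:
  assumes n: "n \<ge> 1"
  shows "is_tight_rank n (n + 4)"
proof -
  define E :: "nat \<Rightarrow> nat \<Rightarrow>\<^sub>0 int" where "E i = Poly_Mapping.single i 1" for i
  define c :: "nat \<Rightarrow> int" where "c i = (if i < n then int (n + i) else int n)" for i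
  define L where "L = zmod.span (E ` {..<n+4})"
  define B where "B f g = (\<Sum>i<n+4. c i * (Poly_Mapping.lookup f i * Poly_Mapping.lookup g i))"
    for f g :: "nat \<Rightarrow>\<^sub>0 int"
  have c: "c i \<ge> int n" and c0: "c i \<ge> 0" for i by (simp_all add: c_def)
  have injE: "inj E"
    by (rule injI) (metis E_def lookup_single_eq lookup_single_not_eq zero_neq_one)
  then have card: "card (E ` {..<n+4}) = n + 4" by (simp add: card_image inj_on_subset)
  have lookupE: "Poly_Mapping.lookup (\<Sum>j<n+4. zscale (u j) (E j)) i = (if i < n + 4 then u i else 0)" for u i
    by (simp add: lookup_sum lookup_zscale E_def if_distrib[of "(*) _"] cong: if_cong)
  have "zmod.independent (E ` {..<n+4})"
    unfolding zmod.dependent_finite[OF finite_imageI[OF finite_lessThan]]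
  proof
    assume "\<exists>u. (\<exists>v\<in>E ` {..<n+4}. u v \<noteq> 0) \<and> (\<Sum>v\<in>E ` {..<n+4}. zscale (u v) v) = 0"
    then obtain u i where u: "(\<Sum>v\<in>E ` {..<n+4}. zscale (u v) v) = 0" "i < n + 4" "u (E i) \<noteq> 0"
      by blast
    have "(\<Sum>j<n+4. zscale (u (E j)) (E j)) = 0"
      using u(1) injE by (simp add: sum.reindex inj_on_subset)
    then show False using lookupE[of "\<lambda>j. u (E j)" i] u(2,3) by simp
  qed
  then have free: "free_zmodule_of_rank (n + 4) L"
    unfolding free_zmodule_of_rank_def L_def using card by blast
  have support: "Poly_Mapping.lookup f i = 0" if "f \<in> L" "i \<ge> n + 4" for f i
    using that(1) unfolding L_def
    by (induction rule: zmod.span_induct_alt)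
      (use that(2) in \<open>auto simp: lookup_add lookup_zscale E_def lookup_single\<close>)
  have pos: "int n \<le> B f f" if f: "f \<in> L" "f \<noteq> 0" for f
  proof -
    obtain i where i: "Poly_Mapping.lookup f i \<noteq> 0" using f(2) poly_mapping_eqI[of f 0] by auto
    then have "i < n + 4" using support f(1) by (meson not_less)
    have "int n * 1 \<le> c i * (Poly_Mapping.lookup f i * Poly_Mapping.lookup f i)"
    proof (rule mult_mono)
      have "0 < (Poly_Mapping.lookup f i)\<^sup>2" using i by simp
      then show "1 \<le> Poly_Mapping.lookup f i * Poly_Mapping.lookup f i"
        unfolding power2_eq_square by linarith
    qed (use c[of i] in auto)
    also have "\<dots> \<le> B f f"
      unfolding B_def
      by (rule member_le_sum) (use \<open>i < n + 4\<close> c0 in auto)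
    finally show ?thesis by simp
  qed
  have lattice: "z_lattice L B"
    unfolding z_lattice_def
  proof (intro conjI ballI allI impI)
    show "\<exists>r. free_zmodule_of_rank r L" using free by blast
    show "0 < B x x" if "x \<in> L" "x \<noteq> 0" for x using pos[OF that] n by simp
    show "B x y = B y x" for x y by (simp add: B_def mult.commute)
    show "B (x + y) z = B x z + B y z" for x y z
      by (simp add: B_def lookup_add distrib_left distrib_right sum.distrib)
    show "B (zscale k x) y = k * B x y" for k x y
      by (simp add: B_def lookup_zscale sum_distrib_left mult_ac)
  qed
  have "represents L B m" if m: "m \<ge> int n" for m
  proof -
    \<comment> \<open>Then \<open>m = (n + i) + n * q\<close> with \<open>i < n\<close>: the basis
      vector of norm \<open>n + i\<close> is used once, and the four coordinates of coefficient
      \<open>n\<close> supply \<open>n * q\<close>.\<close>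
    define q where "q = (m - int n) div int n"
    define i where "i = nat ((m - int n) mod int n)"
    have i: "i < n" using n by (simp add: i_def nat_less_iff)
    have "m = int n * q + int (n + i)"
      using n mult_div_mod_eq[of "int n" "m - int n"] by (simp add: q_def i_def)
    moreover have "q \<ge> 0" using m n by (simp add: q_def div_int_pos_iff)
    then obtain x1 x2 x3 x4 where "q = x1\<^sup>2 + x2\<^sup>2 + x3\<^sup>2 + x4\<^sup>2"
      using four_squares unfolding sum_of_four_squares_def by blast
    ultimately have m_eq: "m = int (n + i) + int n * (x1\<^sup>2 + x2\<^sup>2 + x3\<^sup>2 + x4\<^sup>2)" by simp
    define u where "u j = (if j < n then (if j = i then 1 else 0)
      else if j = n then x1 else if j = n + 1 then x2 else if j = n + 2 then x3 else x4)" for j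
    define f where "f = (\<Sum>j<n+4. zscale (u j) (E j))"
    have "f \<in> L"
      unfolding f_def L_def by (intro zmod.span_sum zmod.span_scale zmod.span_base) auto
    moreover have "B f f = (\<Sum>j<n+4. c j * (u j * u j))"
      unfolding B_def f_def lookupE by (intro sum.cong) auto
    then have "B f f = (\<Sum>j<n. c j * (u j * u j)) + int n * (x1\<^sup>2 + x2\<^sup>2 + x3\<^sup>2 + x4\<^sup>2)"
      by (simp add: eval_nat_numeral c_def u_def power2_eq_square algebra_simps)
    moreover have "(\<Sum>j<n. c j * (u j * u j)) = (\<Sum>j<n. if j = i then int (n + i) else 0)"
      by (intro sum.cong) (auto simp: c_def u_def)
    ultimately have "B f f = m" using i m_eq by simp
    with \<open>f \<in> L\<close> show ?thesis unfolding represents_def by blast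
  qed
  moreover have "B 0 0 = 0" by (simp add: B_def)
  ultimately have "{m. m \<noteq> 0 \<and> represents L B m} = T_set n"
    using pos n by (fastforce simp: T_set_def represents_def)
  then have "tight_universal n L B" using lattice by (simp add: tight_universal_def)
  then show ?thesis unfolding is_tight_rank_def using free by blast
qed

section \<open>The bounds for t(n) and its growth\<close>

lemma tight_rank_bounds:
  assumes "n \<ge> 1"
  shows "4 \<le> tight_rank n" "n + 4 \<le> 2 ^ tight_rank n"
proof -
  \<comment> \<open>Existence of some tight rank ensures that the \<open>LEAST\<close> is attained
    by a lattice.\<close>
  have "is_tight_rank n (tight_rank n)"
    unfolding tight_rank_def using ex_tight_rank[OF assms] by (rule LeastI)
  then obtain X :: "(nat \<Rightarrow>\<^sub>0 int) set" and B where
    "finite X" "zmod.independent X" "tight_universal n (zmod.span X) B" "card X = tight_rank n"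
    unfolding is_tight_rank_def free_zmodule_of_rank_def by blast
  then show "4 \<le> tight_rank n" "n + 4 \<le> 2 ^ tight_rank n"
    using tight_universal_rank_ge_4 tight_universal_rank_bound assms by metis+
qed

theorem theorem4p1:
  shows "(\<forall>n\<ge>1. max 4 (log 2 (real n + 4)) \<le> real (tight_rank n)) \<and>
         filterlim tight_rank at_top sequentially"
proof
  show "\<forall>n\<ge>1. max 4 (log 2 (real n + 4)) \<le> real (tight_rank n)"
  proof (intro allI impI)
    fix n :: nat assume n: "n \<ge> 1"
    have "log 2 (real n + 4) \<le> real (tight_rank n)"
      using log2_of_power_le[OF tight_rank_bounds(2)[OF n]] by simp
    then show "max 4 (log 2 (real n + 4)) \<le> real (tight_rank n)"
      using tight_rank_bounds(1)[OF n] by simp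
  qed
  show "filterlim tight_rank at_top sequentially"
    unfolding filterlim_at_top
  proof
    fix Z :: nat
    show "eventually (\<lambda>n. Z \<le> tight_rank n) sequentially"
      using eventually_ge_at_top[of "2 ^ Z"]
    proof eventually_elim
      case (elim n)
      have "(1::nat) \<le> 2 ^ Z" by simp
      then have "n + 4 \<le> 2 ^ tight_rank n" using elim by (intro tight_rank_bounds(2)) linarith
      then have "(2::nat) ^ Z \<le> 2 ^ tight_rank n" using elim by linarith
      then show ?case by (simp add: power_increasing_iff)
    qed
  qed
qed

end
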